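(* Let $n \geq 3$ and $1 \leq m \leq n$ be integers, let $f : \mathbb{R}^n \to \mathbb{R}$ and $g : \mathbb{R}^n \to \mathbb{R}^m$ be twice continuously differentiable, and let $L : \mathbb{R}^n \times \mathbb{R}^m \to \mathbb{R}$, $L(x,\lambda) = f(x) + \lambda^T g(x)$, be the Lagrangian of the problem of optimizing $f$ under the equality constraints $g(x) = 0$. Let $(\bar{x},\bar{\lambda})$ be a stationary point of $L$ with respect to the joint variable $(x,\lambda) \in \mathbb{R}^{n+m}$, and assume that the bordered Hessian of $L$ at $(\bar{x},\bar{\lambda})$ is non-singular. Then this bordered Hessian is indefinite, and $(\bar{x},\bar{\lambda})$ is a saddle point of $L$.
   Context: The bordered Hessian of $L$ is the $(n+m)\times(n+m)$ Hessian matrix of $L$ viewed as a function of the joint vector $(x,\lambda)$: $$H_b(x,\lambda) = \begin{pmatrix} \nabla^2 f(x) + \sum_{k=1}^m \lambda_k \nabla^2 g_k(x) & Dg(x)^T \\ Dg(x) & 0_{m,m} \end{pmatrix},$$ where $Dg(x)$ is the $m\times n$ Jacobian matrix of $g$ at $x$ and $\nabla^2$ denotes the $n \times n$ Hessian matrix. A stationary point of $L$ is a point $(\bar{x},\bar{\lambda})$ at which the gradient of $L$ with respect to $(x,\lambda)$ vanishes. A symmetric matrix is indefinite if it has at least one positive and at least one negative eigenvalue. A saddle point is a stationary point that is neither a local minimum nor a local maximum. *)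

theory Defs
  imports "HOL-Analysis.Analysis"
begin

text \<open>Second derivatives are taken in the Frechet sense; continuity of \<open>F''\<close> is with respect
  to the operator norm.\<close>

definition twice_continuously_differentiable ::
    "('a::real_normed_vector \<Rightarrow> 'b::real_normed_vector) \<Rightarrow> bool" where
  "twice_continuously_differentiable F \<longleftrightarrow>
     (\<exists>(F' :: 'a \<Rightarrow> 'a \<Rightarrow>\<^sub>L 'b) (F'' :: 'a \<Rightarrow> 'a \<Rightarrow>\<^sub>L ('a \<Rightarrow>\<^sub>L 'b)).
        (\<forall>x. (F has_derivative blinfun_apply (F' x)) (at x)) \<and>
        (\<forall>x. (F' has_derivative blinfun_apply (F'' x)) (at x)) \<and>
        continuous_on UNIV F'')"

definition partial_deriv :: "'n::finite \<Rightarrow> (real^'n \<Rightarrow> real) \<Rightarrow> real^'n \<Rightarrow> real" where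
  "partial_deriv i F x = deriv (\<lambda>t. F (x + t *\<^sub>R axis i 1)) 0"

definition hessian :: "(real^'n::finite \<Rightarrow> real) \<Rightarrow> real^'n \<Rightarrow> real^'n^'n" where
  "hessian F x = (\<chi> i j. partial_deriv i (partial_deriv j F) x)"

definition stationary_point :: "('a::real_inner \<Rightarrow> real) \<Rightarrow> 'a \<Rightarrow> bool" where
  "stationary_point F z \<longleftrightarrow> GDERIV F z :> 0"

definition local_minimum :: "('a::topological_space \<Rightarrow> real) \<Rightarrow> 'a \<Rightarrow> bool" where
  "local_minimum F z \<longleftrightarrow> (\<forall>\<^sub>F w in nhds z. F z \<le> F w)"

definition local_maximum :: "('a::topological_space \<Rightarrow> real) \<Rightarrow> 'a \<Rightarrow> bool" where
  "local_maximum F z \<longleftrightarrow> (\<forall>\<^sub>F w in nhds z. F w \<le> F z)"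

definition saddle_point :: "('a::real_inner \<Rightarrow> real) \<Rightarrow> 'a \<Rightarrow> bool" where
  "saddle_point F z \<longleftrightarrow>
     stationary_point F z \<and> \<not> local_minimum F z \<and> \<not> local_maximum F z"

definition is_eigenvalue :: "real^'n^'n::finite \<Rightarrow> real \<Rightarrow> bool" where
  "is_eigenvalue A c \<longleftrightarrow> (\<exists>v. v \<noteq> 0 \<and> A *v v = c *\<^sub>R v)"

definition indefinite :: "real^'n^'n::finite \<Rightarrow> bool" where
  "indefinite A \<longleftrightarrow> transpose A = A \<and>
     (\<exists>c>0. is_eigenvalue A c) \<and> (\<exists>c<0. is_eigenvalue A c)"

definition lagrangian ::
    "(real^'n \<Rightarrow> real) \<Rightarrow> (real^'n \<Rightarrow> real^'m) \<Rightarrow> (real^'n) \<times> (real^'m) \<Rightarrow> real" where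
  "lagrangian f g = (\<lambda>(x, l). f x + l \<bullet> g x)"

text \<open>The joint vector has index type \<^typ>\<open>'n + 'm\<close>: the coordinates of
  \<^term>\<open>x\<close> come from \<^const>\<open>Inl\<close>, those of the multiplier from \<^const>\<open>Inr\<close>.\<close>

definition join_vec :: "real^'n \<Rightarrow> real^'m \<Rightarrow> real^('n::finite + 'm::finite)" where
  "join_vec x l = (\<chi> i. case i of Inl a \<Rightarrow> x $ a | Inr k \<Rightarrow> l $ k)"

definition left_part :: "real^('n::finite + 'm::finite) \<Rightarrow> real^'n" where
  "left_part z = (\<chi> a. z $ Inl a)"

definition right_part :: "real^('n::finite + 'm::finite) \<Rightarrow> real^'m" where
  "right_part z = (\<chi> k. z $ Inr k)"

definition bordered_hessian ::
    "(real^'n \<Rightarrow> real) \<Rightarrow> (real^'n \<Rightarrow> real^'m) \<Rightarrow> real^'n \<Rightarrow> real^'m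
      \<Rightarrow> real^('n::finite + 'm::finite)^('n + 'm)" where
  "bordered_hessian f g x l =
     hessian (\<lambda>z. lagrangian f g (left_part z, right_part z)) (join_vec x l)"

definition bordered_block :: "real^'n^'n \<Rightarrow> real^'n^'m \<Rightarrow> real^('n::finite + 'm::finite)^('n + 'm)" where
  "bordered_block A B =
     (\<chi> i j. case i of
        Inl a \<Rightarrow> (case j of Inl b \<Rightarrow> A $ a $ b | Inr k \<Rightarrow> transpose B $ a $ k)
      | Inr k \<Rightarrow> (case j of Inl b \<Rightarrow> B $ k $ b | Inr _ \<Rightarrow> 0))"

text \<open>The lemmas below show that for twice continuously differentiable \<^term>\<open>f\<close> and
  \<^term>\<open>g\<close> the Hessian of the Lagrangian in the joint variable has the usual bordered
  block form.\<close>

lemma left_part_join [simp]: "left_part (join_vec x l) = x"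
  by (simp add: left_part_def join_vec_def vec_eq_iff)

lemma right_part_join [simp]: "right_part (join_vec x l) = l"
  by (simp add: right_part_def join_vec_def vec_eq_iff)

lemma parts_add_axis:
  "left_part (z + t *\<^sub>R axis (Inl a) 1) = left_part z + t *\<^sub>R axis a 1"
  "right_part (z + t *\<^sub>R axis (Inl a) 1) = right_part z"
  "left_part (z + t *\<^sub>R axis (Inr k) 1) = left_part z"
  "right_part (z + t *\<^sub>R axis (Inr k) 1) = right_part z + t *\<^sub>R axis k 1"
  by (auto simp: left_part_def right_part_def vec_eq_iff axis_def)

lemma DERIV_along_axis:
  fixes F :: "real^'n::finite \<Rightarrow> real"
  assumes "(F has_derivative D) (at x)"
  shows "((\<lambda>t. F (x + t *\<^sub>R axis i 1)) has_real_derivative D (axis i 1)) (at 0)"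
proof -
  have lin: "linear D" using assms has_derivative_linear by blast
  have "((\<lambda>t. x + t *\<^sub>R axis i 1) has_derivative (\<lambda>t. t *\<^sub>R axis i (1::real))) (at (0::real))"
    by (auto intro!: derivative_eq_intros)
  moreover have "(F has_derivative D) (at (x + 0 *\<^sub>R axis i 1))" using assms by simp
  ultimately have "((\<lambda>t. F (x + t *\<^sub>R axis i 1)) has_derivative (\<lambda>t. D (t *\<^sub>R axis i 1))) (at (0::real))"
    by (rule has_derivative_compose)
  moreover have "(\<lambda>t. D (t *\<^sub>R axis i 1)) = (*) (D (axis i 1))"
    using lin by (auto simp: linear_cmul mult.commute)
  ultimately show ?thesis by (simp add: has_field_derivative_def)
qed

lemma partial_deriv_eq:
  "(F has_derivative D) (at x) \<Longrightarrow> partial_deriv i F x = D (axis i 1)"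
  unfolding partial_deriv_def by (rule DERIV_imp_deriv[OF DERIV_along_axis])

lemma DERIV_partial_deriv:
  "F differentiable at x \<Longrightarrow>
   ((\<lambda>t. F (x + t *\<^sub>R axis i 1)) has_real_derivative partial_deriv i F x) (at 0)"
  using DERIV_along_axis partial_deriv_eq unfolding differentiable_def by metis

lemma twice_continuously_differentiable_partials:
  fixes F :: "real^'n::finite \<Rightarrow> 'b::real_normed_vector"
  assumes "twice_continuously_differentiable F" and P: "bounded_linear P"
  shows "(\<lambda>x. P (F x)) differentiable at x"
    and "partial_deriv i (\<lambda>x. P (F x)) differentiable at x"
proof -
  from assms(1) obtain F' F'' where
    1: "\<And>x. (F has_derivative blinfun_apply (F' x)) (at x)" and
    2: "\<And>x. (F' has_derivative blinfun_apply (F'' x)) (at x)"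
    unfolding twice_continuously_differentiable_def by blast
  have d: "((\<lambda>x. P (F x)) has_derivative (\<lambda>h. P (F' x h))) (at x)" for x
    by (rule bounded_linear.has_derivative[OF P 1])
  then show "(\<lambda>x. P (F x)) differentiable at x"
    unfolding differentiable_def by blast
  have "partial_deriv i (\<lambda>x. P (F x)) = (\<lambda>x. P (F' x (axis i 1)))"
    using partial_deriv_eq[OF d] by blast
  moreover have "((\<lambda>x. P (F' x (axis i 1))) has_derivative (\<lambda>h. P (F'' x h (axis i 1)))) (at x)"
    using 2[of x] by (auto intro!: derivative_eq_intros bounded_linear.has_derivative[OF P])
  ultimately show "partial_deriv i (\<lambda>x. P (F x)) differentiable at x"
    unfolding differentiable_def by auto
qed

lemma bordered_hessian_eq_block:
  fixes f :: "real^'n::finite \<Rightarrow> real" and g :: "real^'n \<Rightarrow> real^'m::finite"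
  assumes f: "twice_continuously_differentiable f" and g: "twice_continuously_differentiable g"
  shows "bordered_hessian f g x l =
     bordered_block (hessian f x + (\<Sum>k\<in>UNIV. l $ k *\<^sub>R hessian (\<lambda>y. g y $ k) x))
       (jacobian g (at x))"
proof -
  define J where "J = (\<lambda>z :: real^('n + 'm). lagrangian f g (left_part z, right_part z))"
  have J: "J z = f (left_part z) + (\<Sum>k\<in>UNIV. right_part z $ k * g (left_part z) $ k)" for z
    by (simp add: J_def lagrangian_def inner_vec_def)
  note f1 = twice_continuously_differentiable_partials[OF f bounded_linear_ident]
  note g1 = twice_continuously_differentiable_partials[OF g bounded_linear_vec_nth]
  have pl: "partial_deriv (Inl b) J = (\<lambda>z. partial_deriv b f (left_part z)
      + (\<Sum>k\<in>UNIV. right_part z $ k * partial_deriv b (\<lambda>y. g y $ k) (left_part z)))" for b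
  proof
    fix z
    show "partial_deriv (Inl b) J z = partial_deriv b f (left_part z)
      + (\<Sum>k\<in>UNIV. right_part z $ k * partial_deriv b (\<lambda>y. g y $ k) (left_part z))"
      unfolding partial_deriv_def[of "Inl b"] J parts_add_axis
      by (rule DERIV_imp_deriv) (intro DERIV_add DERIV_sum DERIV_cmult DERIV_partial_deriv f1 g1)
  qed
  have pr: "partial_deriv (Inr k) J = (\<lambda>z. g (left_part z) $ k)" for k
  proof
    fix z
    have "((\<lambda>t. J (z + t *\<^sub>R axis (Inr k) 1)) has_real_derivative
        0 + (\<Sum>i\<in>UNIV. (axis k 1 :: real^'m) $ i * g (left_part z) $ i)) (at 0)"
      unfolding J parts_add_axis
      by (intro DERIV_add DERIV_sum DERIV_const) (auto intro!: derivative_eq_intros)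
    moreover have "(\<Sum>i\<in>UNIV. (axis k 1 :: real^'m) $ i * g (left_part z) $ i) = g (left_part z) $ k"
      by (simp add: axis_def if_distrib[of "\<lambda>c. c * _"] cong: if_cong)
    ultimately show "partial_deriv (Inr k) J z = g (left_part z) $ k"
      unfolding partial_deriv_def by (simp add: DERIV_imp_deriv)
  qed
  let ?z = "join_vec x l"
  have ll: "partial_deriv (Inl a) (partial_deriv (Inl b) J) ?z =
      partial_deriv a (partial_deriv b f) x
      + (\<Sum>k\<in>UNIV. l $ k * partial_deriv a (partial_deriv b (\<lambda>y. g y $ k)) x)" for a b
    unfolding partial_deriv_def[of "Inl a"] pl parts_add_axis left_part_join right_part_join
    by (rule DERIV_imp_deriv) (intro DERIV_add DERIV_sum DERIV_cmult DERIV_partial_deriv f1 g1)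
  have "g differentiable at x"
    using g unfolding twice_continuously_differentiable_def differentiable_def by blast
  then have gJ: "(g has_derivative (\<lambda>h. jacobian g (at x) *v h)) (at x)"
    by (simp add: jacobian_works)
  have Jg: "partial_deriv b (\<lambda>y. g y $ k) x = jacobian g (at x) $ k $ b" for b k
    using partial_deriv_eq[OF bounded_linear.has_derivative[OF bounded_linear_vec_nth gJ]]
    by (simp add: matrix_vector_mul_component inner_axis)
  have lr: "partial_deriv (Inl a) (partial_deriv (Inr k) J) ?z = jacobian g (at x) $ k $ a" for a k
    unfolding partial_deriv_def[of "Inl a"] pr parts_add_axis left_part_join
    by (simp add: Jg[symmetric] partial_deriv_def)
  have rl: "partial_deriv (Inr k) (partial_deriv (Inl b) J) ?z = jacobian g (at x) $ k $ b" for b k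
  proof -
    have "((\<lambda>t. partial_deriv (Inl b) J (?z + t *\<^sub>R axis (Inr k) 1)) has_real_derivative
        0 + (\<Sum>i\<in>UNIV. (axis k 1 :: real^'m) $ i * jacobian g (at x) $ i $ b)) (at 0)"
      unfolding pl parts_add_axis left_part_join right_part_join Jg
      by (intro DERIV_add DERIV_sum DERIV_const) (auto intro!: derivative_eq_intros)
    moreover have "(\<Sum>i\<in>UNIV. (axis k 1 :: real^'m) $ i * jacobian g (at x) $ i $ b) = jacobian g (at x) $ k $ b"
      by (simp add: axis_def if_distrib[of "\<lambda>c. c * _"] cong: if_cong)
    ultimately show ?thesis
      unfolding partial_deriv_def[of "Inr k"] by (simp add: DERIV_imp_deriv)
  qed
  have rr: "partial_deriv (Inr k) (partial_deriv (Inr j) J) ?z = 0" for k j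
    unfolding partial_deriv_def[of "Inr k"] pr parts_add_axis by simp
  show ?thesis
    unfolding bordered_hessian_def J_def[symmetric]
    by (auto simp: vec_eq_iff hessian_def bordered_block_def ll lr rl rr transpose_def
        split: sum.splits)
qed

end

theory Submission
  imports Defs
begin

text \<open>Non-singularity makes the map \<open>\<mu> \<mapsto> Dg(x)\<^sup>T \<mu>\<close> injective, so some
  \<open>u = Dg(x)\<^sup>T \<mu>\<close> is non-zero. In the direction \<open>(u, \<tau>\<mu>)\<close> the quadratic form of the bordered
  Hessian equals \<open>C + 2\<tau>|u|\<^sup>2\<close>, since its lower right block vanishes; so it takes both signs
  as \<open>\<tau>\<close> varies. Along a line in such a direction the Lagrangian has
  vanishing first and positive (negative) second derivative, which excludes a local maximum
  (minimum), and the maximum of the Rayleigh quotient is a positive eigenvalue.\<close>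

section \<open>Symmetry of second derivatives and of the bordered Hessian\<close>

text \<open>The mean value theorem in direction \<open>u\<close> turns the second difference into
  \<open>s\<close> times a difference of two first derivatives in direction \<open>u\<close>. Both
  are then replaced by the linearization of \<open>\<lambda>y. F' y u\<close> at
  \<open>x\<close>.\<close>

lemma second_difference_bound:
  fixes F :: "'a::real_normed_vector \<Rightarrow> real"
  assumes F': "\<And>y. (F has_derivative F' y) (at y)"
    and F2: "((\<lambda>y. F' y u) has_derivative (\<lambda>h. F2 h u)) (at x)"
    and "e > 0"
  shows "\<exists>d>0. \<forall>s. 0 < s \<and> s < d \<longrightarrow>
    \<bar>F (x + s *\<^sub>R u + s *\<^sub>R v) - F (x + s *\<^sub>R u) - F (x + s *\<^sub>R v) + F x - s\<^sup>2 * F2 v u\<bar> \<le> e * s\<^sup>2"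
proof -
  \<comment> \<open>Both displacements from \<open>x\<close> used below have norm at most
    \<open>s * M\<close>, so \<open>s < d / M\<close> keeps them within reach of
    \<open>approx\<close>; the summand 1 keeps \<open>M\<close> positive when \<open>u\<close> and
    \<open>v\<close> vanish. With \<open>e1\<close>, two errors of size \<open>e1 * (s * M)\<close>
    add up to \<open>e * s\<close>.\<close>
  define M where "M = norm u + norm v + 1"
  have M: "M > 0" by (simp add: M_def add_nonneg_pos)
  define e1 where "e1 = e / (2 * M)"
  have e1: "e1 > 0" using \<open>e > 0\<close> M by (simp add: e1_def)
  have lin: "linear (\<lambda>h. F2 h u)" using F2 has_derivative_linear by blast
  obtain d where d: "d > 0" and
    approx: "\<And>y. norm (y - x) < d \<Longrightarrow> norm (F' y u - F' x u - F2 (y - x) u) \<le> e1 * norm (y - x)"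
    using F2 e1 unfolding has_derivative_at_alt by blast
  have "\<bar>F (x + s *\<^sub>R u + s *\<^sub>R v) - F (x + s *\<^sub>R u) - F (x + s *\<^sub>R v) + F x - s\<^sup>2 * F2 v u\<bar> \<le> e * s\<^sup>2"
    if s: "0 < s" "s < d / M" for s
  proof -
    have sM: "s * M < d" using s M by (simp add: pos_less_divide_eq)
    \<comment> \<open>The second difference is \<open>p s - p 0\<close>: the increment by
      \<open>s *\<^sub>R v\<close>, compared at the two ends of the segment along
      \<open>u\<close>.\<close>
    define p where "p = (\<lambda>t. F (x + t *\<^sub>R u + s *\<^sub>R v) - F (x + t *\<^sub>R u))"
    have DF: "((\<lambda>t. F (a + t *\<^sub>R u)) has_real_derivative F' (a + t *\<^sub>R u) u) (at t)" for a t
    proof -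
      have "((\<lambda>t. a + t *\<^sub>R u) has_derivative (\<lambda>t. t *\<^sub>R u)) (at t)"
        by (auto intro!: derivative_eq_intros)
      then have "((\<lambda>t. F (a + t *\<^sub>R u)) has_derivative (\<lambda>t'. F' (a + t *\<^sub>R u) (t' *\<^sub>R u))) (at t)"
        by (rule has_derivative_compose[OF _ F'])
      moreover have "(\<lambda>t'. F' (a + t *\<^sub>R u) (t' *\<^sub>R u)) = (*) (F' (a + t *\<^sub>R u) u)"
        using has_derivative_linear[OF F'] by (auto simp: linear_cmul mult.commute)
      ultimately show ?thesis by (simp add: has_field_derivative_def)
    qed
    have Dp: "(p has_real_derivative
        F' (x + t *\<^sub>R u + s *\<^sub>R v) u - F' (x + t *\<^sub>R u) u) (at t)" for t
      unfolding p_def using DERIV_diff[OF DF[of "x + s *\<^sub>R v" t] DF[of x t]]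
      by (simp add: ac_simps)
    obtain t where t: "0 < t" "t < s" and
      mvt: "p s - p 0 = (s - 0) * (F' (x + t *\<^sub>R u + s *\<^sub>R v) u - F' (x + t *\<^sub>R u) u)"
      using MVT2[OF s(1) Dp] by blast
    define a where "a = t *\<^sub>R u + s *\<^sub>R v"
    define b where "b = t *\<^sub>R u"
    have "norm b = t * norm u" using t by (simp add: b_def)
    also have "\<dots> \<le> s * norm u" using t by (intro mult_right_mono) auto
    also have "\<dots> \<le> s * M" using s by (simp add: M_def)
    finally have b: "norm b \<le> s * M" .
    have "norm a \<le> t * norm u + s * norm v"
      using norm_triangle_ineq[of "t *\<^sub>R u" "s *\<^sub>R v"] t s by (simp add: a_def)
    also have "\<dots> \<le> s * norm u + s * norm v" using t by (intro add_right_mono mult_right_mono) auto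
    also have "\<dots> \<le> s * M" using s by (simp add: M_def algebra_simps)
    finally have a: "norm a \<le> s * M" .
    have fa: "\<bar>F' (x + a) u - F' x u - F2 a u\<bar> \<le> e1 * (s * M)"
      using order_trans[OF approx[of "x + a"] mult_left_mono[of _ "s * M"]] a sM e1 by simp
    have fb: "\<bar>F' (x + b) u - F' x u - F2 b u\<bar> \<le> e1 * (s * M)"
      using order_trans[OF approx[of "x + b"] mult_left_mono[of _ "s * M"]] b sM e1 by simp
    \<comment> \<open>Both displacements contain \<open>t *\<^sub>R u\<close>, so by linearity the
      unknown intermediate point \<open>t\<close> cancels.\<close>
    have "F2 a u = F2 b u + s * F2 v u"
      unfolding a_def b_def using linear_add[OF lin] linear_cmul[OF lin] by simp
    then have "\<bar>(F' (x + a) u - F' (x + b) u) - s * F2 v u\<bar> \<le> 2 * (e1 * (s * M))"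
      using fa fb by linarith
    also have "\<dots> = e * s" using M by (simp add: e1_def)
    finally have "s * \<bar>(F' (x + a) u - F' (x + b) u) - s * F2 v u\<bar> \<le> s * (e * s)"
      using s by simp
    moreover have "p s - p 0 - s\<^sup>2 * F2 v u = s * ((F' (x + a) u - F' (x + b) u) - s * F2 v u)"
      unfolding mvt a_def b_def by (simp add: algebra_simps power2_eq_square)
    then have "\<bar>p s - p 0 - s\<^sup>2 * F2 v u\<bar> = s * \<bar>(F' (x + a) u - F' (x + b) u) - s * F2 v u\<bar>"
      using s by (simp add: abs_mult)
    ultimately have "\<bar>p s - p 0 - s\<^sup>2 * F2 v u\<bar> \<le> s * (e * s)" by simp
    then show ?thesis by (simp add: p_def power2_eq_square algebra_simps)
  qed
  then show ?thesis using d M by (intro exI[of _ "d / M"]) simp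
qed

text \<open>The second difference \<open>F (x + s u + s v) - F (x + s u) - F (x + s v) + F x\<close> is symmetric in
  \<open>u\<close> and \<open>v\<close>; divided by \<open>s\<^sup>2\<close>, it tends to both sides.\<close>

lemma second_derivative_symmetric:
  fixes F :: "'a::real_normed_vector \<Rightarrow> real"
  assumes F': "\<And>y. (F has_derivative F' y) (at y)"
    and F2: "\<And>w. ((\<lambda>y. F' y w) has_derivative (\<lambda>h. F2 h w)) (at x)"
  shows "F2 u v = F2 v u"
proof -
  have "\<bar>F2 v u - F2 u v\<bar> \<le> 0 + e" if "e > 0" for e
  proof -
    have e: "e / 2 > 0" using that by simp
    obtain d1 where d1: "d1 > 0" and
      1: "\<And>s. 0 < s \<and> s < d1 \<Longrightarrow>
        \<bar>F (x + s *\<^sub>R u + s *\<^sub>R v) - F (x + s *\<^sub>R u) - F (x + s *\<^sub>R v) + F x - s\<^sup>2 * F2 v u\<bar> \<le> e / 2 * s\<^sup>2"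
      using second_difference_bound[of F F' u "\<lambda>h _. F2 h u", OF F' F2 e] by blast
    obtain d2 where d2: "d2 > 0" and
      2: "\<And>s. 0 < s \<and> s < d2 \<Longrightarrow>
        \<bar>F (x + s *\<^sub>R v + s *\<^sub>R u) - F (x + s *\<^sub>R v) - F (x + s *\<^sub>R u) + F x - s\<^sup>2 * F2 u v\<bar> \<le> e / 2 * s\<^sup>2"
      using second_difference_bound[of F F' v "\<lambda>h _. F2 h v", OF F' F2 e] by blast
    define s where "s = min d1 d2 / 2"
    have s: "0 < s" "s < d1" "s < d2" using d1 d2 by (auto simp: s_def)
    have "x + s *\<^sub>R v + s *\<^sub>R u = x + s *\<^sub>R u + s *\<^sub>R v" by simp
    with 1[OF conjI[OF s(1,2)]] 2[OF conjI[OF s(1,3)]] have "\<bar>s\<^sup>2 * F2 v u - s\<^sup>2 * F2 u v\<bar> \<le> e * s\<^sup>2"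
      by (simp only:)
    then have "s\<^sup>2 * \<bar>F2 v u - F2 u v\<bar> \<le> s\<^sup>2 * e"
      by (simp add: right_diff_distrib[symmetric] abs_mult mult.commute[of e])
    then show ?thesis using s by simp
  qed
  then have "\<bar>F2 v u - F2 u v\<bar> \<le> 0" by (rule field_le_epsilon)
  then show ?thesis by simp
qed

text \<open>The Hessian entries are values of \<open>P\<close> composed with the second Frechet
  derivative on axis vectors, where symmetry is available. The map \<open>P\<close> lets one
  statement serve both \<open>f\<close> (identity) and the components of \<open>g\<close>
  (coordinate projections).\<close>

lemma transpose_hessian:
  fixes F :: "real^'n::finite \<Rightarrow> 'b::real_normed_vector"
  assumes "twice_continuously_differentiable F" and P: "bounded_linear P"
  shows "transpose (hessian (\<lambda>x. P (F x)) x) = hessian (\<lambda>x. P (F x)) x"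
proof -
  from assms(1) obtain F' F'' where
    1: "\<And>x. (F has_derivative blinfun_apply (F' x)) (at x)" and
    2: "\<And>x. (F' has_derivative blinfun_apply (F'' x)) (at x)"
    unfolding twice_continuously_differentiable_def by blast
  have d: "((\<lambda>x. P (F x)) has_derivative (\<lambda>h. P (F' x h))) (at x)" for x
    by (rule bounded_linear.has_derivative[OF P 1])
  have d2: "((\<lambda>y. P (F' y w)) has_derivative (\<lambda>h. P (F'' x h w))) (at x)" for w
    using 2[of x] by (auto intro!: derivative_eq_intros bounded_linear.has_derivative[OF P])
  have "partial_deriv i (partial_deriv j (\<lambda>x. P (F x))) x = P (F'' x (axis i 1) (axis j 1))" for i j
  proof -
    have "partial_deriv j (\<lambda>x. P (F x)) = (\<lambda>x. P (F' x (axis j 1)))"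
      using partial_deriv_eq[OF d] by blast
    then show ?thesis using partial_deriv_eq[OF d2] by simp
  qed
  moreover have "P (F'' x v w) = P (F'' x w v)" for v w
    by (rule second_derivative_symmetric[of "\<lambda>x. P (F x)" "\<lambda>x h. P (F' x h)"]) (rule d, rule d2)
  ultimately show ?thesis
    by (simp add: transpose_def hessian_def vec_eq_iff)
qed

lemma transpose_bordered_hessian:
  fixes f :: "real^'n::finite \<Rightarrow> real" and g :: "real^'n \<Rightarrow> real^'m::finite"
  assumes f: "twice_continuously_differentiable f" and g: "twice_continuously_differentiable g"
  shows "transpose (bordered_hessian f g x l) = bordered_hessian f g x l"
proof -
  have "hessian f x $ a $ b = hessian f x $ b $ a" for a b
    by (subst transpose_hessian[OF f bounded_linear_ident, symmetric]) (simp add: transpose_def)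
  moreover have "hessian (\<lambda>y. g y $ k) x $ a $ b = hessian (\<lambda>y. g y $ k) x $ b $ a" for k a b
    by (subst transpose_hessian[OF g bounded_linear_vec_nth, symmetric]) (simp add: transpose_def)
  ultimately show ?thesis
    unfolding bordered_hessian_eq_block[OF f g]
    by (auto simp: bordered_block_def transpose_def vec_eq_iff split: sum.splits)
qed

section \<open>The quadratic form of a bordered block matrix\<close>

lemma sum_UNIV_Plus:
  fixes h :: "'a::finite + 'b::finite \<Rightarrow> 'c::comm_monoid_add"
  shows "(\<Sum>i\<in>UNIV. h i) = (\<Sum>a\<in>UNIV. h (Inl a)) + (\<Sum>b\<in>UNIV. h (Inr b))"
  by (simp add: UNIV_Plus_UNIV[symmetric] sum.Plus del: UNIV_Plus_UNIV)

lemma bordered_block_mult: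
  "bordered_block A B *v join_vec y r = join_vec (A *v y + transpose B *v r) (B *v y)"
  by (simp add: vec_eq_iff matrix_vector_mult_def bordered_block_def join_vec_def sum_UNIV_Plus
      split: sum.splits del: transpose_matrix_vector)

lemma inner_join_vec: "join_vec y r \<bullet> join_vec y' r' = y \<bullet> y' + r \<bullet> r'"
  by (simp add: inner_vec_def sum_UNIV_Plus join_vec_def)

text \<open>The two off-diagonal blocks contribute equally, and the zero block leaves no term
  quadratic in \<open>r\<close>. For fixed \<open>y\<close> the form is thus affine in
  \<open>r\<close>, which is what lets it change sign.\<close>

lemma bordered_block_form:
  "join_vec y r \<bullet> (bordered_block A B *v join_vec y r) = y \<bullet> (A *v y) + 2 * (r \<bullet> (B *v y))"
  by (simp add: bordered_block_mult inner_join_vec inner_add_right dot_lmul_matrix[symmetric]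
      inner_commute)

section \<open>Eigenvalues from the sign of the quadratic form\<close>

text \<open>Let \<open>c\<close> be the maximum of the form \<open>q\<close> on the unit sphere,
  attained at \<open>w\<close>. By homogeneity \<open>q y - c * (y \<bullet> y)\<close> is at most 0
  on the whole space and equals 0 at \<open>w\<close>, so \<open>w\<close> is an unconstrained
  maximizer and the derivative there vanishes.\<close>

lemma positive_eigenvalue:
  fixes A :: "real^'n::finite^'n"
  assumes sym: "transpose A = A" and pos: "v \<bullet> (A *v v) > 0"
  shows "\<exists>c>0. is_eigenvalue A c"
proof -
  define q where "q = (\<lambda>y. y \<bullet> (A *v y))"
  have v: "v \<noteq> 0" using pos by auto
  have "continuous_on (sphere 0 1) q"
    unfolding q_def
    by (intro continuous_on_inner continuous_on_id linear_continuous_on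
        matrix_vector_mul_bounded_linear)
  moreover have "sgn v \<in> sphere 0 1" using v by (simp add: norm_sgn)
  ultimately obtain w where w: "norm w = 1" and
    max: "\<And>y. norm y = 1 \<Longrightarrow> q y \<le> q w"
    using continuous_attains_sup[of "sphere 0 1" q] by fastforce
  define c where "c = q w"
  have scale: "q (a *\<^sub>R y) = a\<^sup>2 * q y" for a y
    by (simp add: q_def matrix_vector_mult_scaleR power2_eq_square)
  have le: "q y \<le> c * (y \<bullet> y)" for y
  proof (cases "y = 0")
    case False
    have "q y = (norm y)\<^sup>2 * q (sgn y)"
      using scale[of "norm y" "sgn y"] False by (simp add: sgn_div_norm)
    also have "\<dots> \<le> (norm y)\<^sup>2 * c"
      using max[of "sgn y"] False by (intro mult_left_mono) (auto simp: norm_sgn c_def)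
    finally show ?thesis by (simp add: power2_norm_eq_inner mult.commute)
  qed (simp add: q_def)
  have "0 < c * (v \<bullet> v)" using pos le[of v] by (simp add: q_def)
  then have "c > 0" using inner_ge_zero[of v] by (simp add: zero_less_mult_iff)
  have symA: "w \<bullet> (A *v h) = h \<bullet> (A *v w)" for h
    using dot_lmul_matrix[of w A h] transpose_matrix_vector[of A w] sym by (simp add: inner_commute)
  have "((\<lambda>y. q y - c * (y \<bullet> y)) has_derivative
      (\<lambda>h. (w \<bullet> (A *v h) + h \<bullet> (A *v w)) - c * (w \<bullet> h + h \<bullet> w))) (at w)"
    unfolding q_def
    by (intro has_derivative_diff has_derivative_inner has_derivative_mult_right has_derivative_ident
        bounded_linear_imp_has_derivative matrix_vector_mul_bounded_linear)
  also have "(\<lambda>h. (w \<bullet> (A *v h) + h \<bullet> (A *v w)) - c * (w \<bullet> h + h \<bullet> w))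
      = (\<lambda>h. 2 * (h \<bullet> (A *v w - c *\<^sub>R w)))"
    unfolding symA by (simp add: fun_eq_iff inner_diff_right inner_commute[of w])
  finally have "((\<lambda>y. q y - c * (y \<bullet> y)) has_derivative
      (\<lambda>h. 2 * (h \<bullet> (A *v w - c *\<^sub>R w)))) (at w)" .
  moreover have "\<forall>y\<in>UNIV. q y - c * (y \<bullet> y) \<le> q w - c * (w \<bullet> w)"
    using le w by (simp add: c_def norm_eq_1)
  ultimately have "(\<lambda>h. 2 * (h \<bullet> (A *v w - c *\<^sub>R w))) = (\<lambda>h. 0)"
    by (intro differential_zero_maxmin[of w UNIV]) auto
  \<comment> \<open>The vanishing derivative is evaluated at
    \<open>h = A *v w - c *\<^sub>R w\<close> itself.\<close>
  then have "(A *v w - c *\<^sub>R w) \<bullet> (A *v w - c *\<^sub>R w) = 0"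
    by (metis mult_eq_0_iff zero_neq_numeral)
  then have "A *v w = c *\<^sub>R w" by simp
  with \<open>c > 0\<close> w show ?thesis unfolding is_eigenvalue_def by (metis norm_zero zero_neq_one)
qed

lemma matrix_vector_mult_uminus: "(- A) *v v = - (A *v v)" for A :: "real^'n^'m"
  by (simp add: vec_eq_iff matrix_vector_mult_def sum_negf)

lemma negative_eigenvalue:
  fixes A :: "real^'n::finite^'n"
  assumes sym: "transpose A = A" and neg: "v \<bullet> (A *v v) < 0"
  shows "\<exists>c<0. is_eigenvalue A c"
proof -
  have "transpose (- A) = - A"
    using sym by (simp add: transpose_def vec_eq_iff)
  moreover have "v \<bullet> ((- A) *v v) > 0" using neg by (simp add: matrix_vector_mult_uminus)
  ultimately obtain c where "c > 0" "is_eigenvalue (- A) c" using positive_eigenvalue by blast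
  then have "is_eigenvalue A (- c)"
    unfolding is_eigenvalue_def matrix_vector_mult_uminus
    by (metis minus_equation_iff scaleR_minus_left)
  with \<open>c > 0\<close> show ?thesis by (metis neg_less_0_iff_less)
qed

section \<open>Second-order behaviour along a line\<close>

text \<open>Since \<open>D\<close> vanishes at 0 with positive slope, it is positive just to the
  right of 0; by the mean value theorem \<open>F\<close> then strictly exceeds \<open>F z\<close> at
  small positive \<open>s\<close>.\<close>

lemma not_local_maximum_along_line:
  fixes F :: "'a::real_normed_vector \<Rightarrow> real"
  assumes D: "\<And>s. ((\<lambda>s. F (z + s *\<^sub>R w)) has_real_derivative D s) (at s)"
    and D0: "D 0 = 0" and D2: "(D has_real_derivative c) (at 0)" and "c > 0"
  shows "\<not> local_maximum F z"
proof
  assume "local_maximum F z"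
  moreover have "((\<lambda>s. z + s *\<^sub>R w) \<longlongrightarrow> z) (at_right (0::real))"
    by (auto intro!: tendsto_eq_intros)
  ultimately have "\<forall>\<^sub>F s in at_right 0. F (z + s *\<^sub>R w) \<le> F z"
    unfolding local_maximum_def filterlim_def by (auto simp: le_filter_def eventually_filtermap)
  then obtain b where b: "b > 0" and le: "\<And>s. 0 < s \<Longrightarrow> s < b \<Longrightarrow> F (z + s *\<^sub>R w) \<le> F z"
    unfolding eventually_at_right_field by auto
  obtain d where d: "d > 0" and pos: "\<And>h. 0 < h \<Longrightarrow> h < d \<Longrightarrow> 0 < D h"
    using DERIV_pos_inc_right[OF D2 \<open>c > 0\<close>] D0 by auto
  define s where "s = min b d / 2"
  have s: "0 < s" "s < b" "s < d" using b d by (auto simp: s_def)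
  obtain t where "0 < t" "t < s" "F (z + s *\<^sub>R w) - F (z + 0 *\<^sub>R w) = (s - 0) * D t"
    using MVT2[OF s(1) D] by blast
  moreover have "s * D t > 0" using \<open>0 < t\<close> \<open>t < s\<close> s pos by simp
  ultimately show False using le[of s] s by simp
qed

lemma not_local_minimum_along_line:
  fixes F :: "'a::real_normed_vector \<Rightarrow> real"
  assumes D: "\<And>s. ((\<lambda>s. F (z + s *\<^sub>R w)) has_real_derivative D s) (at s)"
    and D0: "D 0 = 0" and D2: "(D has_real_derivative c) (at 0)" and "c < 0"
  shows "\<not> local_minimum F z"
proof -
  have "\<not> local_maximum (\<lambda>y. - F y) z"
    by (rule not_local_maximum_along_line[OF DERIV_minus[OF D] _ DERIV_minus[OF D2]])
      (use D0 \<open>c < 0\<close> in auto)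
  then show ?thesis by (simp add: local_maximum_def local_minimum_def)
qed

text \<open>The constant \<open>C\<close> is quantified before \<open>\<tau>\<close>: it is the
  second derivative along \<open>u\<close> of \<open>f\<close> plus the inner product of the fixed
  \<open>l\<close> with \<open>g\<close>. Hence \<open>\<tau>\<close> can later be chosen to give
  the second derivative any sign, without identifying \<open>C\<close> with a Hessian term.\<close>

lemma lagrangian_along_line:
  fixes f :: "real^'n::finite \<Rightarrow> real" and g :: "real^'n \<Rightarrow> real^'m::finite"
  assumes f: "twice_continuously_differentiable f" and g: "twice_continuously_differentiable g"
    and stat: "stationary_point (lagrangian f g) (x, l)"
  shows "\<exists>C. \<forall>\<tau>. \<exists>D.
    (\<forall>s. ((\<lambda>s. lagrangian f g ((x, l) + s *\<^sub>R (u, \<tau> *\<^sub>R \<mu>))) has_real_derivative D s) (at s)) \<and>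
    D 0 = 0 \<and> (D has_real_derivative C + 2 * \<tau> * (\<mu> \<bullet> (jacobian g (at x) *v u))) (at 0)"
proof -
  from f obtain f' f'' where
    f1: "\<And>x. (f has_derivative blinfun_apply (f' x)) (at x)" and
    f2: "\<And>x. (f' has_derivative blinfun_apply (f'' x)) (at x)"
    unfolding twice_continuously_differentiable_def by blast
  from g obtain g' g'' where
    g1: "\<And>x. (g has_derivative blinfun_apply (g' x)) (at x)" and
    g2: "\<And>x. (g' has_derivative blinfun_apply (g'' x)) (at x)"
    unfolding twice_continuously_differentiable_def by blast
  have J: "jacobian g (at x) *v u = g' x u"
    using g1[of x] jacobian_works[of g "at x"] has_derivative_unique[of g _ x]
    unfolding differentiable_def by metis
  have line: "((\<lambda>s. x + s *\<^sub>R u) has_vector_derivative u) (at s)" for s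
    by (auto intro!: derivative_eq_intros)
  have fl: "((\<lambda>s. f (x + s *\<^sub>R u)) has_vector_derivative f' (x + s *\<^sub>R u) u) (at s)" for s
    using vector_derivative_diff_chain_within[OF line has_derivative_at_withinI[OF f1], of s]
    by (simp add: o_def)
  have gl: "((\<lambda>s. g (x + s *\<^sub>R u)) has_vector_derivative g' (x + s *\<^sub>R u) u) (at s)" for s
    using vector_derivative_diff_chain_within[OF line has_derivative_at_withinI[OF g1], of s]
    by (simp add: o_def)
  have f'l: "((\<lambda>s. f' (x + s *\<^sub>R u)) has_vector_derivative f'' (x + s *\<^sub>R u) u) (at s)" for s
    using vector_derivative_diff_chain_within[OF line has_derivative_at_withinI[OF f2], of s]
    by (simp add: o_def)
  have g'l: "((\<lambda>s. g' (x + s *\<^sub>R u)) has_vector_derivative g'' (x + s *\<^sub>R u) u) (at s)" for s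
    using vector_derivative_diff_chain_within[OF line has_derivative_at_withinI[OF g2], of s]
    by (simp add: o_def)
  define C where "C = f'' x u u + l \<bullet> g'' x u u"
  show ?thesis
  proof (intro exI[of _ C] allI)
    fix \<tau>
    define \<phi> where "\<phi> = (\<lambda>s. lagrangian f g ((x, l) + s *\<^sub>R (u, \<tau> *\<^sub>R \<mu>)))"
    define D where "D = (\<lambda>s. f' (x + s *\<^sub>R u) u + ((l + s *\<^sub>R (\<tau> *\<^sub>R \<mu>)) \<bullet> g' (x + s *\<^sub>R u) u
      + (\<tau> *\<^sub>R \<mu>) \<bullet> g (x + s *\<^sub>R u)))"
    have ll: "((\<lambda>s. l + s *\<^sub>R (\<tau> *\<^sub>R \<mu>)) has_vector_derivative \<tau> *\<^sub>R \<mu>) (at s)" for s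
      by (auto intro!: derivative_eq_intros)
    note prod = bounded_bilinear.has_vector_derivative[OF bounded_bilinear_inner]
    have D1: "(\<phi> has_real_derivative D s) (at s)" for s
      unfolding \<phi>_def D_def lagrangian_def has_real_derivative_iff_has_vector_derivative
      using has_vector_derivative_add[OF fl[of s] prod[OF ll[of s] gl[of s]]] by simp
    have line': "((\<lambda>s. z + s *\<^sub>R w) has_derivative (\<lambda>s. s *\<^sub>R w)) (at 0)"
      for z w :: "(real^'n) \<times> (real^'m)"
      by (auto intro!: derivative_eq_intros)
    \<comment> \<open>Stationarity makes the derivative of \<open>\<phi>\<close> at 0 vanish;
      comparison with the product rule formula \<open>D\<close> gives
      \<open>D 0 = 0\<close>.\<close>
    have "((x, l) + 0 *\<^sub>R (u, \<tau> *\<^sub>R \<mu>)) = (x, l)" by (simp add: zero_prod_def)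
    then have "(lagrangian f g has_derivative (\<lambda>h. 0)) (at ((x, l) + 0 *\<^sub>R (u, \<tau> *\<^sub>R \<mu>)))"
      using stat by (simp add: stationary_point_def gderiv_def)
    from has_derivative_compose[OF line' this] have "(\<phi> has_derivative (\<lambda>s. 0)) (at 0)"
      unfolding \<phi>_def .
    then have "(\<phi> has_real_derivative 0) (at 0)"
      by (simp add: has_field_derivative_def lambda_zero)
    with D1 have D0: "D 0 = 0" using DERIV_unique by blast
    have f'u: "((\<lambda>s. f' (x + s *\<^sub>R u) u) has_vector_derivative f'' (x + s *\<^sub>R u) u u) (at s)" for s
      by (rule bounded_linear.has_vector_derivative[OF blinfun.bounded_linear_left f'l])
    have g'u: "((\<lambda>s. g' (x + s *\<^sub>R u) u) has_vector_derivative g'' (x + s *\<^sub>R u) u u) (at s)" for s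
      by (rule bounded_linear.has_vector_derivative[OF blinfun.bounded_linear_left g'l])
    \<comment> \<open>The factor 2 arises because
      \<open>(\<tau> *\<^sub>R \<mu>) \<bullet> g' x u\<close> occurs twice: from differentiating
      the multiplier in the first inner product of \<open>D\<close>, and \<open>g\<close> in the
      second.\<close>
    have "(D has_real_derivative C + 2 * \<tau> * (\<mu> \<bullet> g' x u)) (at 0)"
      unfolding D_def C_def has_real_derivative_iff_has_vector_derivative
      using has_vector_derivative_add[OF f'u[of 0] has_vector_derivative_add[OF
          prod[OF ll[of 0] g'u[of 0]]
          bounded_linear.has_vector_derivative[OF bounded_linear_inner_right gl[of 0], of "\<tau> *\<^sub>R \<mu>"]]]
      by (simp add: algebra_simps)
    with D1 D0 show "\<exists>D. (\<forall>s. ((\<lambda>s. lagrangian f g ((x, l) + s *\<^sub>R (u, \<tau> *\<^sub>R \<mu>)))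
        has_real_derivative D s) (at s)) \<and>
      D 0 = 0 \<and> (D has_real_derivative C + 2 * \<tau> * (\<mu> \<bullet> (jacobian g (at x) *v u))) (at 0)"
      unfolding J \<phi>_def by blast
  qed
qed

section \<open>Indefiniteness and the saddle point property\<close>

theorem mainTheorem1:
  fixes f :: "real^'n::finite \<Rightarrow> real"
    and g :: "real^'n \<Rightarrow> real^'m::finite"
    and x :: "real^'n" and l :: "real^'m"
  assumes "CARD('n) \<ge> 3"
    and "1 \<le> CARD('m)" and "CARD('m) \<le> CARD('n)"
    and "twice_continuously_differentiable f"
    and "twice_continuously_differentiable g"
    and "stationary_point (lagrangian f g) (x, l)"
    and "invertible (bordered_hessian f g x l)"
  shows "indefinite (bordered_hessian f g x l) \<and> saddle_point (lagrangian f g) (x, l)"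
proof -
  note f = assms(4) and g = assms(5) and stat = assms(6)
  define H where "H = bordered_hessian f g x l"
  define A where "A = hessian f x + (\<Sum>k\<in>UNIV. l $ k *\<^sub>R hessian (\<lambda>y. g y $ k) x)"
  define B where "B = jacobian g (at x)"
  have H: "H = bordered_block A B"
    unfolding H_def A_def B_def by (rule bordered_hessian_eq_block[OF f g])
  \<comment> \<open>The vector with all entries 1 is a witness.\<close>
  obtain \<mu> :: "real^'m" where "\<mu> \<noteq> 0" by (metis zero_neq_one)
  define u where "u = transpose B *v \<mu>"
  have "u \<noteq> 0"
  proof
    \<comment> \<open>Then \<open>join_vec 0 \<mu>\<close> would lie in the kernel of
      \<open>H\<close>, whose product with it is \<open>join_vec u 0\<close>.\<close>
    assume "u = 0"
    then have "H *v join_vec 0 \<mu> = join_vec 0 0"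
      by (simp add: H bordered_block_mult u_def del: transpose_matrix_vector)
    also have "\<dots> = H *v 0" by (simp add: vec_eq_iff join_vec_def split: sum.splits)
    finally have "join_vec 0 \<mu> = (0 :: real^('n + 'm))"
      using assms(7) inj_matrix_vector_mult[of H] unfolding H_def by (metis injD)
    then have "right_part (join_vec (0 :: real^'n) \<mu>) = right_part (0 :: real^('n + 'm))"
      by (rule arg_cong)
    then show False using \<open>\<mu> \<noteq> 0\<close> by (simp add: right_part_def vec_eq_iff join_vec_def)
  qed
  have Bu: "\<mu> \<bullet> (B *v u) = u \<bullet> u"
    by (simp add: dot_lmul_matrix[symmetric] u_def)
  \<comment> \<open>The coefficient of \<open>\<tau>\<close> is \<open>2 * (u \<bullet> u)\<close>,
    which is non-zero, so every real value is attained. This serves twice: for the quadratic form of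
    \<open>H\<close> and for the second derivative along the line, each time with targets 1 and
    -1.\<close>
  have solve: "\<exists>\<tau>. C + 2 * \<tau> * (\<mu> \<bullet> (B *v u)) = c" for C c
    using \<open>u \<noteq> 0\<close> unfolding Bu by (intro exI[of _ "(c - C) / (2 * (u \<bullet> u))"]) (simp add: field_simps)
  have form: "join_vec u (\<tau> *\<^sub>R \<mu>) \<bullet> (H *v join_vec u (\<tau> *\<^sub>R \<mu>))
      = u \<bullet> (A *v u) + 2 * \<tau> * (\<mu> \<bullet> (B *v u))" for \<tau>
    unfolding H bordered_block_form by simp
  have sym: "transpose H = H"
    unfolding H_def by (rule transpose_bordered_hessian[OF f g])
  have "\<exists>c>0. is_eigenvalue H c"
    using positive_eigenvalue[OF sym] form solve[of "u \<bullet> (A *v u)" 1] by (metis zero_less_one)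
  moreover have "\<exists>c<0. is_eigenvalue H c"
    using negative_eigenvalue[OF sym] form solve[of "u \<bullet> (A *v u)" "-1"]
    by (metis neg_less_0_iff_less zero_less_one)
  ultimately have "indefinite H" using sym by (simp add: indefinite_def)
  moreover obtain C where C: "\<And>\<tau>. \<exists>D.
    (\<forall>s. ((\<lambda>s. lagrangian f g ((x, l) + s *\<^sub>R (u, \<tau> *\<^sub>R \<mu>))) has_real_derivative D s) (at s)) \<and>
    D 0 = 0 \<and> (D has_real_derivative C + 2 * \<tau> * (\<mu> \<bullet> (B *v u))) (at 0)"
    using lagrangian_along_line[OF f g stat] unfolding B_def by blast
  have "\<not> local_maximum (lagrangian f g) (x, l)"
  proof -
    obtain \<tau> where \<tau>: "C + 2 * \<tau> * (\<mu> \<bullet> (B *v u)) = 1" using solve by blast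
    with C[of \<tau>] show ?thesis
      using not_local_maximum_along_line[of "lagrangian f g" "(x, l)" "(u, \<tau> *\<^sub>R \<mu>)" _ 1] by auto
  qed
  moreover have "\<not> local_minimum (lagrangian f g) (x, l)"
  proof -
    obtain \<tau> where \<tau>: "C + 2 * \<tau> * (\<mu> \<bullet> (B *v u)) = - 1" using solve by blast
    with C[of \<tau>] show ?thesis
      using not_local_minimum_along_line[of "lagrangian f g" "(x, l)" "(u, \<tau> *\<^sub>R \<mu>)" _ "- 1"] by auto
  qed
  ultimately show ?thesis using stat by (simp add: H_def saddle_point_def)
qed

end
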